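(* Let $T\in\mathscr L(M,V')$ and let $z\in E$ be a solution of $Tz=0$ with $\|z\|_M=1$ that satisfies $\varepsilon^{\mathrm{int}}_h(z)\leq 1/2$. Fix $r$ such that $\|z\|_E\leq r$, and let $z_h\in M_h$ be a solution of $$\|T_hz_h\|_{V_h'}=\alpha(T_h)\quad\text{with}\quad \|z_h\|_M=1\quad\text{and}\quad \langle z_h,z\rangle_M\geq 0.$$ If $\beta(T_h)>0$, then $$\|z_h-p_h(z)\|_M\leq\frac{4}{\beta(T_h)}\left(\sqrt2\, r\,\varepsilon^{\mathrm{op}}_h+2\rho(T)\,\varepsilon^{\mathrm{int}}_h(z)\right).$$ Moreover, if $\varepsilon^{\mathrm{op}}_h\to0$ as $h\to 0$ and $(T_h)_{h>0}$ satisfies the discrete inf-sup condition (there exists $\beta^*>0$ such that $\beta^*\le\beta(T_h)$ for all $h>0$), then, with $z_h\in M_h$ chosen for each $h$ to be a solution of $\|T_hz_h\|_{V_h'}=\alpha(T_h)$ with $\|z_h\|_M=1$ and $\langle z_h,z\rangle_M\geq 0$, $\|z_h-z\|_M\to0$ as $h\to0$.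
   Context: Setting. $M$ and $V$ are real Hilbert spaces; $E\subset M$ is a Banach space (with its own norm $\|\cdot\|_E$) that is dense in $M$; $V'$ is the dual of $V$ (bounded linear forms) with the operator norm; $\mathscr L(M,V')$ is the space of bounded linear operators. Discretization. $(M_h)_{h>0}$ and $(V_h)_{h>0}$ are families of finite-dimensional subspaces of $M$ and $V$ that approach $M$ and $V$ respectively: a family $(X_h)_{h>0}$ of subspaces of $X$ approaches $X$ if for every $x\in X$ there are $x_h\in X_h$ with $\|x_h-x\|_X\to0$ as $h\to0$. $M_h$, $V_h$ carry the norms of $M$, $V$. One has $M_h\subset E$, and $E_h$ denotes $M_h$ endowed with the $E$-norm. $\pi_h:M\to M_h$ is the orthogonal projection, and it is assumed that $\|\pi_h m\|_E\le\|m\|_E$ for all $m\in E$. For $m\in M$ with $\pi_hm\neq0$, $p_h(m):=\pi_hm/\|\pi_hm\|_M$. For nonzero $\mu\in M$, $\varepsilon^{\mathrm{int}}_h(\mu):=\|\pi_h\mu-\mu\|_M/\|\mu\|_M$. $V_h'$ is the space of linear forms on $V_h$ with norm $\|f\|_{V_h'}=\sup_{v\in V_h}\langle f,v\rangle/\|v\|_V$; elements of $V'$ are regarded as elements of $V_h'$ by restriction. For each $h>0$, $T_h\in\mathscr L(M_h,V_h')$ is a given operator, and $$\varepsilon^{\mathrm{op}}_h:=\sup_{\mu\in E_h}\sup_{v\in V_h}\frac{\langle (T_h-T)\mu,v\rangle_{V_h',V_h}}{\|\mu\|_E\|v\|_V}.$$ Constants. All infima and suprema of quotients are over nonzero vectors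 (infimum over the empty set is $+\infty$). For $T\in\mathscr L(M,V')$, $$\alpha(T):=\inf_{\mu\in M}\sup_{v\in V}\frac{\langle T\mu,v\rangle_{V',V}}{\|\mu\|_M\|v\|_V},\qquad \rho(T):=\sup_{\mu\in M}\sup_{v\in V}\frac{\langle T\mu,v\rangle_{V',V}}{\|\mu\|_M\|v\|_V},$$ $$\beta_e(T):=\inf_{\mu\in M,\ \mu\perp e}\ \sup_{v\in V}\frac{\langle T\mu,v\rangle_{V',V}}{\|\mu\|_M\|v\|_V}\ (e\in M,\ e\ne0),\qquad \beta(T):=\sup_{e\in M,\ \|e\|_M=1}\beta_e(T).$$ $\alpha(T_h)$ and $\beta(T_h)$ are defined by the same formulas with $(T,M,V)$ replaced by $(T_h,M_h,V_h)$ (orthogonality being that of $M$). *)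

theory Defs
  imports "HOL-Analysis.Analysis"
begin

text \<open>
  Infima and suprema of quotients are taken in the extended reals, since the infimum over an
  empty set of vectors has to be \<open>\<infinity>\<close>. Conversely, a supremum of quotients over an empty set of
  vectors has to be \<open>0\<close> (e.g. the norm of the only linear form on the zero space). Whenever a
  nonzero vector is available these suprema are nonnegative anyway, because the quotients change
  sign with \<open>v\<close>; so inserting \<open>0\<close> affects only the empty case.
\<close>

definition qsup :: "'a set \<Rightarrow> ('a \<Rightarrow> ereal) \<Rightarrow> ereal" where
  "qsup A f = Sup (insert 0 (f ` A))"

text \<open>
  An operator from a subspace \<open>X\<close> into the dual of a subspace \<open>Y\<close> is represented by the function
  \<open>b\<close> with \<open>b \<mu> v = \<langle>T \<mu>, v\<rangle>\<close>; only its values for \<open>\<mu> \<in> X\<close> and \<open>v \<in> Y\<close> are meaningful.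
\<close>

definition operator_into_dual ::
    "'m::real_normed_vector set \<Rightarrow> 'v::real_normed_vector set \<Rightarrow> ('m \<Rightarrow> 'v \<Rightarrow> real) \<Rightarrow> bool" where
  "operator_into_dual X Y b \<longleftrightarrow>
     (\<forall>\<mu>\<in>X. \<forall>v\<in>Y. \<forall>w\<in>Y. b \<mu> (v + w) = b \<mu> v + b \<mu> w) \<and>
     (\<forall>\<mu>\<in>X. \<forall>v\<in>Y. \<forall>c. b \<mu> (c *\<^sub>R v) = c * b \<mu> v) \<and>
     (\<forall>\<mu>\<in>X. \<forall>\<nu>\<in>X. \<forall>v\<in>Y. b (\<mu> + \<nu>) v = b \<mu> v + b \<nu> v) \<and>
     (\<forall>\<mu>\<in>X. \<forall>c. \<forall>v\<in>Y. b (c *\<^sub>R \<mu>) v = c * b \<mu> v) \<and>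
     (\<exists>K. \<forall>\<mu>\<in>X. \<forall>v\<in>Y. \<bar>b \<mu> v\<bar> \<le> K * norm \<mu> * norm v)"

definition pairing ::
    "('m::real_normed_vector \<Rightarrow>\<^sub>L ('v::real_normed_vector \<Rightarrow>\<^sub>L real)) \<Rightarrow> 'm \<Rightarrow> 'v \<Rightarrow> real" where
  "pairing T \<mu> v = blinfun_apply (blinfun_apply T \<mu>) v"

definition dual_norm :: "'v::real_normed_vector set \<Rightarrow> ('v \<Rightarrow> real) \<Rightarrow> ereal" where
  "dual_norm Y f = qsup (Y - {0}) (\<lambda>v. ereal (f v / norm v))"

definition alpha ::
    "'m::real_normed_vector set \<Rightarrow> 'v::real_normed_vector set \<Rightarrow> ('m \<Rightarrow> 'v \<Rightarrow> real) \<Rightarrow> ereal" where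
  "alpha X Y b =
     (INF \<mu>\<in>X - {0}. qsup (Y - {0}) (\<lambda>v. ereal (b \<mu> v / (norm \<mu> * norm v))))"

definition rho ::
    "'m::real_normed_vector set \<Rightarrow> 'v::real_normed_vector set \<Rightarrow> ('m \<Rightarrow> 'v \<Rightarrow> real) \<Rightarrow> ereal" where
  "rho X Y b =
     qsup (X - {0}) (\<lambda>\<mu>. qsup (Y - {0}) (\<lambda>v. ereal (b \<mu> v / (norm \<mu> * norm v))))"

definition beta_at ::
    "'m::real_inner set \<Rightarrow> 'v::real_normed_vector set \<Rightarrow> ('m \<Rightarrow> 'v \<Rightarrow> real) \<Rightarrow> 'm \<Rightarrow> ereal" where
  "beta_at X Y b e =
     (INF \<mu>\<in>{\<mu> \<in> X - {0}. orthogonal \<mu> e}.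
        qsup (Y - {0}) (\<lambda>v. ereal (b \<mu> v / (norm \<mu> * norm v))))"

definition beta ::
    "'m::real_inner set \<Rightarrow> 'v::real_normed_vector set \<Rightarrow> ('m \<Rightarrow> 'v \<Rightarrow> real) \<Rightarrow> ereal" where
  "beta X Y b = (SUP e\<in>{e \<in> X. norm e = 1}. beta_at X Y b e)"

definition banach_subspace :: "'a::real_vector set \<Rightarrow> ('a \<Rightarrow> real) \<Rightarrow> bool" where
  "banach_subspace E N \<longleftrightarrow>
     subspace E \<and>
     (\<forall>x\<in>E. 0 \<le> N x) \<and>
     (\<forall>x\<in>E. N x = 0 \<longleftrightarrow> x = 0) \<and>
     (\<forall>x\<in>E. \<forall>y\<in>E. N (x + y) \<le> N x + N y) \<and>
     (\<forall>x\<in>E. \<forall>c. N (c *\<^sub>R x) = \<bar>c\<bar> * N x) \<and>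
     (\<forall>X::nat \<Rightarrow> 'a.
        (\<forall>n. X n \<in> E) \<and> (\<forall>e>0. \<exists>k. \<forall>m\<ge>k. \<forall>n\<ge>k. N (X m - X n) < e)
        \<longrightarrow> (\<exists>x\<in>E. (\<lambda>n. N (X n - x)) \<longlonglongrightarrow> 0))"

definition finite_dim_subspace :: "'a::real_vector set \<Rightarrow> bool" where
  "finite_dim_subspace S \<longleftrightarrow> (\<exists>B. finite B \<and> S = span B)"

definition approaches_space :: "(real \<Rightarrow> 'a::real_normed_vector set) \<Rightarrow> bool" where
  "approaches_space Xh \<longleftrightarrow>
     (\<forall>x. \<exists>xh. (\<forall>h>0. xh h \<in> Xh h) \<and> ((\<lambda>h. norm (xh h - x)) \<longlongrightarrow> 0) (at_right 0))"

definition orth_proj :: "'a::real_inner set \<Rightarrow> 'a \<Rightarrow> 'a" where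
  "orth_proj S x = (THE y. y \<in> S \<and> (\<forall>w\<in>S. orthogonal (x - y) w))"

definition normalized_proj :: "'a::real_inner set \<Rightarrow> 'a \<Rightarrow> 'a" where
  "normalized_proj S x = orth_proj S x /\<^sub>R norm (orth_proj S x)"

definition eps_int :: "'a::real_inner set \<Rightarrow> 'a \<Rightarrow> real" where
  "eps_int S \<mu> = norm (orth_proj S \<mu> - \<mu>) / norm \<mu>"

definition eps_op ::
    "('m::real_normed_vector \<Rightarrow> real) \<Rightarrow> 'm set \<Rightarrow> 'v::real_normed_vector set \<Rightarrow>
     ('m \<Rightarrow> 'v \<Rightarrow> real) \<Rightarrow> ('m \<Rightarrow>\<^sub>L ('v \<Rightarrow>\<^sub>L real)) \<Rightarrow> ereal" where
  "eps_op N X Y b T =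
     qsup (X - {0}) (\<lambda>\<mu>. qsup (Y - {0})
       (\<lambda>v. ereal ((b \<mu> v - pairing T \<mu> v) / (N \<mu> * norm v))))"

end

theory Submission
  imports Defs
begin

text \<open>
  The plane spanned by \<open>z\<^sub>h\<close> and \<open>p = p\<^sub>h(z)\<close> contains a combination \<open>w = s z\<^sub>h + t p\<close> with
  \<open>\<bar>s\<bar> + \<bar>t\<bar> = 1\<close> that is orthogonal to a prescribed \<open>e\<close>. As \<open>z\<^sub>h\<close> minimizes
  the residual on the unit sphere, the residual of \<open>w\<close> is at most that of \<open>p\<close>, so that
  \<open>\<beta>\<^sub>e(T\<^sub>h) \<parallel>w\<parallel> \<le> \<parallel>T\<^sub>h p\<parallel>\<close>. Since \<open>z\<^sub>h\<close> and \<open>p\<close> are unit vectors at a non-obtuse angle,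
  \<open>\<parallel>z\<^sub>h - p\<parallel> \<le> 2 \<parallel>w\<parallel>\<close>. The residual of \<open>p\<close> is controlled by consistency:
  \<open>T\<^sub>h p = (T\<^sub>h - T) p + T (\<pi>\<^sub>h z - z) / \<parallel>\<pi>\<^sub>h z\<parallel>\<close> with \<open>\<parallel>\<pi>\<^sub>h z\<parallel>\<^sup>2 = 1 - \<parallel>\<pi>\<^sub>h z - z\<parallel>\<^sup>2\<close>.
\<close>

section \<open>Orthogonal projection onto finite-dimensional subspaces\<close>

lemma finite_dim_subspace_imp_subspace: "finite_dim_subspace S \<Longrightarrow> subspace S"
  by (auto simp: finite_dim_subspace_def)

text \<open>Expansion in an orthogonal spanning set produces a point with the defining property, and
  two such points differ by an element of \<open>S\<close> that is orthogonal to itself. Hence the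
  \<open>THE\<close> in \<open>orth_proj\<close> is well defined.\<close>

lemma orth_proj_props:
  fixes S :: "'a::real_inner set"
  assumes "finite_dim_subspace S"
  shows orth_proj_in: "orth_proj S x \<in> S"
    and orth_proj_orthogonal: "w \<in> S \<Longrightarrow> orthogonal (x - orth_proj S x) w"
proof -
  obtain B where B: "finite B" "S = span B"
    using assms by (auto simp: finite_dim_subspace_def)
  obtain C where C: "finite C" "span C = span B" "pairwise orthogonal C"
    using basis_orthogonal[OF B(1)] by blast
  let ?P = "\<lambda>y. y \<in> S \<and> (\<forall>w\<in>S. orthogonal (x - y) w)"
  \<comment> \<open>\<open>C\<close> may contain the zero vector; its term is a multiple of
    \<open>b = 0\<close> and vanishes, whatever the quotient by \<open>b \<bullet> b\<close>
    evaluates to.\<close>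
  let ?y = "\<Sum>b\<in>C. (b \<bullet> x / (b \<bullet> b)) *\<^sub>R b"
  have y: "?P ?y"
  proof (intro conjI ballI)
    show "?y \<in> S"
      unfolding B(2) C(2)[symmetric] by (intro span_sum span_scale span_base)
    fix w assume "w \<in> S"
    then have w: "w \<in> span C" using B(2) C(2) by simp
    have "orthogonal (x - ?y) c" if c: "c \<in> C" for c
    proof -
      have "?y \<bullet> c = (\<Sum>b\<in>C. if b = c then x \<bullet> c else 0)"
        unfolding inner_sum_left
      proof (rule sum.cong)
        fix b assume "b \<in> C"
        then show "(b \<bullet> x / (b \<bullet> b)) *\<^sub>R b \<bullet> c = (if b = c then x \<bullet> c else 0)"
          using C(3) c by (auto simp: pairwise_def orthogonal_def inner_commute)
      qed simp
      also have "\<dots> = x \<bullet> c" using C(1) c by simp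
      finally show ?thesis by (simp add: orthogonal_def inner_diff_left)
    qed
    then show "orthogonal (x - ?y) w" by (rule orthogonal_to_span[OF w])
  qed
  have S: "subspace S" using assms by (rule finite_dim_subspace_imp_subspace)
  have uniq: "y1 = y2" if "?P y1" "?P y2" for y1 y2
  proof -
    have d: "y1 - y2 \<in> S" using that S by (auto intro: subspace_diff)
    have "(x - y2) \<bullet> (y1 - y2) = 0" "(x - y1) \<bullet> (y1 - y2) = 0"
      using that d by (auto simp: orthogonal_def)
    then have "(y1 - y2) \<bullet> (y1 - y2) = 0" by (simp add: inner_diff_left)
    then show ?thesis by simp
  qed
  have "?P (orth_proj S x)"
    unfolding orth_proj_def by (rule theI[of ?P, OF y]) (use uniq y in blast)
  then show "orth_proj S x \<in> S" "w \<in> S \<Longrightarrow> orthogonal (x - orth_proj S x) w"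
    by auto
qed

lemma norm_orth_proj_Pythagoras:
  fixes S :: "'a::real_inner set"
  assumes "finite_dim_subspace S"
  shows "(norm x)\<^sup>2 = (norm (orth_proj S x))\<^sup>2 + (norm (orth_proj S x - x))\<^sup>2"
proof -
  have "orthogonal (x - orth_proj S x) (orth_proj S x)"
    by (intro orth_proj_orthogonal orth_proj_in assms)
  from norm_add_Pythagorean[OF this] show ?thesis
    by (simp add: norm_minus_commute)
qed

text \<open>Pythagoras for the splitting of \<open>x - y\<close> into \<open>x - ?p\<close> and
  \<open>?p - y\<close>. This is how an approaching family controls the interpolation error.\<close>

lemma orth_proj_closest:
  fixes S :: "'a::real_inner set"
  assumes "finite_dim_subspace S" "y \<in> S"
  shows "norm (orth_proj S x - x) \<le> norm (y - x)"
proof -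
  let ?p = "orth_proj S x"
  have "?p - y \<in> S"
    using assms by (intro subspace_diff finite_dim_subspace_imp_subspace orth_proj_in)
  then have "orthogonal (x - ?p) (?p - y)"
    by (rule orth_proj_orthogonal[OF assms(1)])
  from norm_add_Pythagorean[OF this]
  have "(norm (x - ?p))\<^sup>2 \<le> (norm (x - y))\<^sup>2" by simp
  then show ?thesis
    by (metis norm_minus_commute norm_ge_zero power2_le_imp_le)
qed

lemma norm_normalized_proj:
  "orth_proj S x \<noteq> 0 \<Longrightarrow> norm (normalized_proj S x) = 1"
  by (simp add: normalized_proj_def)

lemma normalized_proj_in:
  assumes "finite_dim_subspace S"
  shows "normalized_proj S x \<in> S"
  unfolding normalized_proj_def
  by (intro subspace_scale finite_dim_subspace_imp_subspace orth_proj_in assms)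

text \<open>Against \<open>y\<close> in \<open>S\<close>, the vector \<open>x\<close> and its
  projection have the same inner product. The sign condition on the discrete solution thus passes
  from \<open>z\<close> to its normalized projection.\<close>

lemma inner_normalized_proj_nonneg:
  fixes S :: "'a::real_inner set"
  assumes "finite_dim_subspace S" "y \<in> S" "inner y x \<ge> 0"
  shows "inner y (normalized_proj S x) \<ge> 0"
proof -
  have "y \<bullet> (x - orth_proj S x) = 0"
    using orth_proj_orthogonal[OF assms(1,2)] by (simp add: orthogonal_def inner_commute)
  then have "y \<bullet> orth_proj S x = y \<bullet> x"
    by (simp add: inner_diff_right)
  then show ?thesis using assms(3) by (simp add: normalized_proj_def)
qed

text \<open>Normalizing moves the projection by the difference between its norm and
  \<open>norm x = 1\<close>, which is at most the projection error; the triangle inequality then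
  doubles that error.\<close>

lemma norm_normalized_proj_diff_le:
  fixes S :: "'a::real_inner set"
  assumes "norm x = 1" "orth_proj S x \<noteq> 0"
  shows "norm (normalized_proj S x - x) \<le> 2 * norm (orth_proj S x - x)"
proof -
  let ?p = "orth_proj S x"
  have "normalized_proj S x - ?p = (1 / norm ?p - 1) *\<^sub>R ?p"
    by (simp add: normalized_proj_def algebra_simps divide_inverse)
  then have "norm (normalized_proj S x - ?p) = \<bar>1 / norm ?p - 1\<bar> * norm ?p"
    by simp
  also have "\<dots> = \<bar>(1 / norm ?p - 1) * norm ?p\<bar>" by (simp add: abs_mult)
  also have "\<dots> = \<bar>norm x - norm ?p\<bar>" using assms by (simp add: algebra_simps)
  also have "\<dots> \<le> norm (?p - x)" by (metis norm_minus_commute norm_triangle_ineq3)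
  finally show ?thesis
    using norm_triangle_ineq[of "normalized_proj S x - ?p" "?p - x"] by simp
qed

section \<open>Suprema of quotients and pointwise bounds\<close>

lemma qsup_upper: "x \<in> A \<Longrightarrow> f x \<le> qsup A f"
  unfolding qsup_def by (rule Sup_upper) simp

lemma qsup_nonneg: "0 \<le> qsup A f"
  unfolding qsup_def by (rule Sup_upper) simp

lemma qsup_least: "0 \<le> c \<Longrightarrow> (\<And>x. x \<in> A \<Longrightarrow> f x \<le> c) \<Longrightarrow> qsup A f \<le> c"
  by (auto simp: qsup_def intro: Sup_least)

lemma qsup_quotient_le:
  assumes "0 \<le> D" "\<And>v. v \<in> Y \<Longrightarrow> b \<mu> v \<le> D * norm v" "\<mu> \<noteq> 0"
  shows "qsup (Y - {0}) (\<lambda>v. ereal (b \<mu> v / (norm \<mu> * norm v))) \<le> ereal (D / norm \<mu>)"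
  using assms by (intro qsup_least) (auto simp: divide_simps mult.commute)

lemma alpha_le:
  assumes "\<mu> \<in> X" "norm \<mu> = 1" "0 \<le> D" "\<And>v. v \<in> Y \<Longrightarrow> b \<mu> v \<le> D * norm v"
  shows "alpha X Y b \<le> ereal D"
proof -
  have "\<mu> \<noteq> 0" using assms(2) by auto
  then have "qsup (Y - {0}) (\<lambda>v. ereal (b \<mu> v / (norm \<mu> * norm v))) \<le> ereal D"
    using qsup_quotient_le[of D Y b \<mu>] assms by simp
  then show ?thesis
    unfolding alpha_def using assms(1) \<open>\<mu> \<noteq> 0\<close> by (intro INF_lower2[of \<mu>]) auto
qed

lemma beta_at_le:
  assumes "\<mu> \<in> X" "\<mu> \<noteq> 0" "orthogonal \<mu> e" "0 \<le> D" "\<And>v. v \<in> Y \<Longrightarrow> b \<mu> v \<le> D * norm v"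
  shows "beta_at X Y b e \<le> ereal (D / norm \<mu>)"
  unfolding beta_at_def using assms
  by (intro INF_lower2[of \<mu>] qsup_quotient_le) auto

text \<open>The suprema bound quotients from above only; replacing \<open>v\<close> by its negative
  gives the two-sided bound. Oddness is asked for on \<open>Y\<close> alone because the discrete
  forms are meaningful only there.\<close>

lemma abs_le_if_odd:
  fixes f :: "'v::real_vector \<Rightarrow> real"
  assumes "subspace Y" "\<And>v. v \<in> Y \<Longrightarrow> f ((-1) *\<^sub>R v) = - f v" "\<And>v. v \<in> Y \<Longrightarrow> f v \<le> g v"
    "\<And>v. g ((-1) *\<^sub>R v) = g v" "v \<in> Y"
  shows "\<bar>f v\<bar> \<le> g v"
proof -
  have "(-1) *\<^sub>R v \<in> Y" using assms(1,5) by (rule subspace_scale)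
  then have "- f v \<le> g v" using assms(2)[of v] assms(3)[of "(-1) *\<^sub>R v"] assms(4)[of v] assms(5)
    by simp
  then show ?thesis using assms(3,5) by force
qed

text \<open>Converts an extended-real norm bound into a real inequality for each \<open>v\<close>.
  At \<open>v = 0\<close>, which the supremum omits, homogeneity makes both sides zero.\<close>

lemma dual_norm_bound:
  fixes f :: "'v::real_normed_vector \<Rightarrow> real"
  assumes "dual_norm Y f \<le> ereal D" "subspace Y"
    "\<And>v c. v \<in> Y \<Longrightarrow> f (c *\<^sub>R v) = c * f v" "v \<in> Y"
  shows "\<bar>f v\<bar> \<le> D * norm v"
proof (rule abs_le_if_odd[OF assms(2) _ _ _ assms(4)])
  fix v assume v: "v \<in> Y"
  show "f ((-1) *\<^sub>R v) = - f v" using assms(3)[OF v, of "-1"] by simp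
  show "f v \<le> D * norm v"
  proof (cases "v = 0")
    case True
    then show ?thesis using assms(3)[OF v, of 0] by simp
  next
    case False
    have "ereal (f v / norm v) \<le> dual_norm Y f"
      unfolding dual_norm_def using v False by (intro qsup_upper) auto
    also note assms(1)
    finally show ?thesis using False by (simp add: divide_simps)
  qed
qed simp

section \<open>Stability of the discrete minimizer\<close>

text \<open>Orthogonality to \<open>e\<close> is one linear equation in \<open>s\<close> and
  \<open>t\<close>, so it has a nonzero solution, which can be scaled. The norm estimate holds for
  every pair with \<open>\<bar>s\<bar> + \<bar>t\<bar> = 1\<close>: the smallest norm occurs for
  \<open>s = 1/2\<close>, \<open>t = -1/2\<close>, where the combination is half of
  \<open>x - y\<close>.\<close>

lemma exists_orthogonal_combination:
  fixes x y e :: "'a::real_inner"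
  assumes "norm x = 1" "norm y = 1" "inner x y \<ge> 0"
  obtains s t where "\<bar>s\<bar> + \<bar>t\<bar> = 1" "orthogonal (s *\<^sub>R x + t *\<^sub>R y) e"
    "norm (x - y) \<le> 2 * norm (s *\<^sub>R x + t *\<^sub>R y)"
proof -
  define k where "k = inner x y"
  have k: "0 \<le> k" "k \<le> 1"
    using assms norm_cauchy_schwarz[of x y] by (auto simp: k_def)
  have xx: "x \<bullet> x = 1" "y \<bullet> y = 1" using assms by (auto simp: norm_eq_1)
  have main: "norm (x - y) \<le> 2 * norm (s *\<^sub>R x + t *\<^sub>R y)" if st: "\<bar>s\<bar> + \<bar>t\<bar> = 1" for s t
  proof (rule power2_le_imp_le)
    have n1: "(norm (x - y))\<^sup>2 = 2 - 2 * k"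
      unfolding power2_norm_eq_inner k_def
      by (simp add: inner_diff_left inner_diff_right xx inner_commute)
    have n2: "(norm (s *\<^sub>R x + t *\<^sub>R y))\<^sup>2 = s\<^sup>2 + t\<^sup>2 + 2 * (s * t) * k"
      unfolding power2_norm_eq_inner k_def
      by (simp add: inner_add_left inner_add_right xx inner_commute power2_eq_square algebra_simps)
    have q: "s\<^sup>2 + t\<^sup>2 + 2 * \<bar>s * t\<bar> = 1"
      using arg_cong[OF st, of "\<lambda>u. u\<^sup>2"] by (simp add: power2_sum abs_mult)
    have "0 \<le> (\<bar>s\<bar> - \<bar>t\<bar>)\<^sup>2" by simp
    then have m: "4 * \<bar>s * t\<bar> \<le> 1"
      using q by (simp add: power2_diff abs_mult)
    have "2 - 2 * k \<le> 4 * (s\<^sup>2 + t\<^sup>2 + 2 * (s * t) * k)"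
    \<comment> \<open>In both cases \<open>q\<close> eliminates the squares and \<open>m\<close>
      bounds the remaining product. Equal signs leave \<open>2 + 2 * k\<close> on the right, and
      this is where \<open>k \<ge> 0\<close> enters; opposite signs leave exactly
      \<open>2 - 2 * k\<close>.\<close>
    proof (cases "s * t \<ge> 0")
      case True
      have "(1 - k) * (4 * \<bar>s * t\<bar>) \<le> (1 - k) * 1" using m k by (intro mult_left_mono) auto
      then show ?thesis using q k True by (simp add: algebra_simps)
    next
      case False
      have "(1 + k) * (4 * \<bar>s * t\<bar>) \<le> (1 + k) * 1" using m k by (intro mult_left_mono) auto
      then show ?thesis using q k False by (simp add: algebra_simps)
    qed
    then show "(norm (x - y))\<^sup>2 \<le> (2 * norm (s *\<^sub>R x + t *\<^sub>R y))\<^sup>2"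
      by (simp add: power_mult_distrib n1 n2)
  qed simp
  define a c where "a = inner x e" and "c = inner y e"
  show thesis
  proof (cases "\<bar>a\<bar> + \<bar>c\<bar> = 0")
    case True
    show thesis
      by (rule that[of 1 0]) (use main[of 1 0] True in \<open>auto simp: orthogonal_def a_def\<close>)
  next
    case False
    \<comment> \<open>The equation \<open>s * a + t * c = 0\<close> is solved by \<open>c\<close>
      and \<open>- a\<close>; division by \<open>n\<close> normalizes the coefficients. If
      \<open>n\<close> vanishes, \<open>e\<close> is orthogonal to both vectors and the pair
      \<open>1\<close>, \<open>0\<close> serves.\<close>
    define n where "n = \<bar>a\<bar> + \<bar>c\<bar>"
    have n: "n > 0" using False by (simp add: n_def)
    have st: "\<bar>c / n\<bar> + \<bar>- a / n\<bar> = 1"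
      using n by (simp add: n_def add_divide_distrib[symmetric])
    show thesis
      by (rule that[OF st _ main[OF st]])
        (simp add: orthogonal_def inner_diff_left a_def[symmetric] c_def[symmetric])
  qed
qed

lemma operator_into_dual_combination:
  assumes "operator_into_dual X Y b" "subspace X" "x \<in> X" "y \<in> X" "v \<in> Y"
  shows "b (s *\<^sub>R x + t *\<^sub>R y) v = s * b x v + t * b y v"
  using assms unfolding operator_into_dual_def by (simp add: subspace_scale)

lemma operator_into_dual_scale:
  assumes "operator_into_dual X Y b" "x \<in> X" "v \<in> Y"
  shows "b x (c *\<^sub>R v) = c * b x v"
  using assms unfolding operator_into_dual_def by blast

text \<open>As a competitor in the infimum, \<open>y\<close> forces the residual of \<open>x\<close>
  below \<open>D\<close> too, hence also that of any combination with
  \<open>\<bar>s\<bar> + \<bar>t\<bar> = 1\<close>. A real \<open>c\<close> strictly below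
  \<open>beta\<close> is used because that supremum may be infinite or not attained; strictness
  yields an actual \<open>e\<close>.\<close>

lemma inf_sup_stability:
  fixes X :: "'m::real_inner set" and Y :: "'v::real_normed_vector set"
  assumes b: "operator_into_dual X Y b" and X: "subspace X" and Y: "subspace Y"
    and x: "x \<in> X" "norm x = 1" and min: "dual_norm Y (b x) = alpha X Y b"
    and y: "y \<in> X" "norm y = 1" and xy: "inner x y \<ge> 0"
    and D: "0 \<le> D" "\<And>v. v \<in> Y \<Longrightarrow> \<bar>b y v\<bar> \<le> D * norm v"
    and c: "ereal c < beta X Y b"
  shows "c * norm (x - y) \<le> 2 * D"
proof -
  obtain e where e: "ereal c < beta_at X Y b e"
    using c by (auto simp: beta_def less_SUP_iff)
  obtain s t where st: "\<bar>s\<bar> + \<bar>t\<bar> = 1" and orth: "orthogonal (s *\<^sub>R x + t *\<^sub>R y) e"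
    and le: "norm (x - y) \<le> 2 * norm (s *\<^sub>R x + t *\<^sub>R y)"
    using exists_orthogonal_combination[OF x(2) y(2) xy] by blast
  define w where "w = s *\<^sub>R x + t *\<^sub>R y"
  have "dual_norm Y (b x) \<le> ereal D"
    unfolding min by (rule alpha_le[OF y D(1)]) (use D(2) in fastforce)
  then have Dx: "\<bar>b x v\<bar> \<le> D * norm v" if "v \<in> Y" for v
    using Y operator_into_dual_scale[OF b x(1)] that by (rule dual_norm_bound)
  have bw: "b w v \<le> D * norm v" if v: "v \<in> Y" for v
  proof -
    have "b w v = s * b x v + t * b y v"
      unfolding w_def using b X x(1) y(1) v by (rule operator_into_dual_combination)
    also have "\<dots> \<le> \<bar>s\<bar> * \<bar>b x v\<bar> + \<bar>t\<bar> * \<bar>b y v\<bar>"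
      by (intro add_mono) (metis abs_ge_self abs_mult)+
    also have "\<dots> \<le> \<bar>s\<bar> * (D * norm v) + \<bar>t\<bar> * (D * norm v)"
      using Dx D(2) v by (intro add_mono mult_left_mono) auto
    also have "\<dots> = D * norm v" using st by (metis distrib_right mult_1)
    finally show ?thesis .
  qed
  have cw: "c * norm w \<le> D"
  proof (cases "w = 0")
    case False
    have "w \<in> X" unfolding w_def using X x y by (intro subspace_add subspace_scale)
    then have "beta_at X Y b e \<le> ereal (D / norm w)"
      using False orth D(1) bw by (intro beta_at_le) (auto simp: w_def)
    with e have "ereal c < ereal (D / norm w)" by (rule less_le_trans)
    then show ?thesis using False by (simp add: divide_simps split: if_splits)
  qed (use D in simp)
  show ?thesis
  \<comment> \<open>No sign is imposed on \<open>c\<close>, since it later ranges over all reals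
    below \<open>beta\<close>.\<close>
  proof (cases "c \<ge> 0")
    case True
    then have "c * norm (x - y) \<le> c * (2 * norm w)"
      using le by (intro mult_left_mono) (auto simp: w_def)
    then show ?thesis using cw by simp
  next
    case False
    then have "c * norm (x - y) \<le> 0" by (simp add: mult_nonpos_nonneg)
    then show ?thesis using D(1) by linarith
  qed
qed

section \<open>Continuity and consistency of the operators\<close>

text \<open>The operator norm of \<open>T\<close> bounds the supremum, so it is a real number and
  can serve as the continuity constant.\<close>

lemma rho_UNIV_real:
  obtains R where "0 \<le> R" "rho UNIV UNIV (pairing T) = ereal R"
    "\<And>\<mu> v. \<bar>pairing T \<mu> v\<bar> \<le> R * norm \<mu> * norm v"
proof -
  define q where "q \<mu> = qsup (UNIV - {0}) (\<lambda>v. ereal (pairing T \<mu> v / (norm \<mu> * norm v)))" for \<mu>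
  have rho: "rho UNIV UNIV (pairing T) = qsup (UNIV - {0}) q"
    by (simp add: rho_def q_def[abs_def])
  have bd: "pairing T \<mu> v \<le> norm T * (norm \<mu> * norm v)" for \<mu> v
  proof -
    have "pairing T \<mu> v \<le> norm (blinfun_apply T \<mu>) * norm v"
      using norm_blinfun[of "blinfun_apply T \<mu>" v] by (auto simp: pairing_def)
    also have "\<dots> \<le> norm T * norm \<mu> * norm v"
      by (intro mult_right_mono norm_blinfun) auto
    finally show ?thesis by (simp add: mult.assoc)
  qed
  have "rho UNIV UNIV (pairing T) \<le> ereal (norm T)"
    unfolding rho q_def
    by (intro qsup_least) (use bd in \<open>auto simp: divide_simps\<close>)
  moreover have "0 \<le> rho UNIV UNIV (pairing T)" unfolding rho by (rule qsup_nonneg)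
  ultimately obtain R where R: "rho UNIV UNIV (pairing T) = ereal R" "0 \<le> R"
    by (cases "rho UNIV UNIV (pairing T)") auto
  have *: "pairing T \<mu> v \<le> R * norm \<mu> * norm v" for \<mu> v
  proof (cases "\<mu> = 0 \<or> v = 0")
    case True
    then show ?thesis by (auto simp: pairing_def blinfun.zero_right blinfun.zero_left)
  next
    case False
    then have "ereal (pairing T \<mu> v / (norm \<mu> * norm v)) \<le> q \<mu>"
      unfolding q_def by (intro qsup_upper) auto
    also have "\<dots> \<le> ereal R"
      unfolding R(1)[symmetric] rho using False by (intro qsup_upper) auto
    finally show ?thesis using False by (simp add: divide_simps mult_ac)
  qed
  have "\<bar>pairing T \<mu> v\<bar> \<le> R * norm \<mu> * norm v" for \<mu> v
    by (rule abs_le_if_odd[of UNIV]) (use * in \<open>auto simp: pairing_def blinfun.minus_right\<close>)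
  then show thesis using that R by blast
qed

lemma eps_op_nonneg: "0 \<le> eps_op N X Y b T"
  unfolding eps_op_def by (rule qsup_nonneg)

lemma eps_op_bound:
  assumes d: "eps_op N X Y b T \<le> ereal d" and Y: "subspace Y"
    and scale: "\<And>v c. v \<in> Y \<Longrightarrow> b \<mu> (c *\<^sub>R v) = c * b \<mu> v"
    and \<mu>: "\<mu> \<in> X" "\<mu> \<noteq> 0" "N \<mu> > 0" and v: "v \<in> Y"
  shows "\<bar>b \<mu> v - pairing T \<mu> v\<bar> \<le> d * N \<mu> * norm v"
proof (rule abs_le_if_odd[OF Y _ _ _ v])
  fix v assume v: "v \<in> Y"
  show "b \<mu> ((-1) *\<^sub>R v) - pairing T \<mu> ((-1) *\<^sub>R v) = - (b \<mu> v - pairing T \<mu> v)"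
    using scale[OF v, of "-1"] by (simp add: pairing_def blinfun.minus_right)
  show "b \<mu> v - pairing T \<mu> v \<le> d * N \<mu> * norm v"
  proof (cases "v = 0")
    case True
    then show ?thesis
      using scale[OF v, of 0] by (simp add: pairing_def blinfun.zero_right)
  next
    case False
    let ?f = "\<lambda>\<mu> v. ereal ((b \<mu> v - pairing T \<mu> v) / (N \<mu> * norm v))"
    have "?f \<mu> v \<le> qsup (Y - {0}) (?f \<mu>)"
      using v False by (intro qsup_upper) auto
    also have "\<dots> \<le> eps_op N X Y b T"
      unfolding eps_op_def using \<mu> by (intro qsup_upper[where f = "\<lambda>\<mu>. qsup (Y - {0}) (?f \<mu>)"]) auto
    also have "\<dots> \<le> ereal d" by (rule d)
    finally show ?thesis using False \<mu>(3) by (simp add: divide_simps mult_ac)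
  qed
qed simp

lemma residual_normalized_proj_le:
  assumes E: "banach_subspace E N"
    and X: "finite_dim_subspace X" "X \<subseteq> E" and Y: "subspace Y"
    and b: "operator_into_dual X Y b"
    and proj: "N (orth_proj X z) \<le> r"
    and z: "blinfun_apply T z = 0" "norm z = 1"
    and eps: "eps_int X z \<le> 1 / 2"
    and d: "eps_op N X Y b T \<le> ereal d" "0 \<le> d"
    and R: "0 \<le> R" "\<And>\<mu> v. \<bar>pairing T \<mu> v\<bar> \<le> R * norm \<mu> * norm v"
    and v: "v \<in> Y"
  shows "\<bar>b (normalized_proj X z) v\<bar> \<le> (sqrt 2 * r * d + 2 * R * eps_int X z) * norm v"
proof -
  define q where "q = orth_proj X z"
  define p where "p = normalized_proj X z"
  define \<epsilon> where "\<epsilon> = eps_int X z"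
  have \<epsilon>: "\<epsilon> = norm (q - z)" "0 \<le> \<epsilon>" "\<epsilon> \<le> 1 / 2"
    using z(2) eps by (auto simp: \<epsilon>_def eps_int_def q_def)
  \<comment> \<open>By Pythagoras \<open>norm q\<close> squared is at least \<open>3/4\<close>; the
    weaker bound \<open>1/2\<close> gives the factor \<open>sqrt 2\<close> for dividing by
    \<open>norm q\<close>.\<close>
  have "\<epsilon>\<^sup>2 \<le> (1 / 2)\<^sup>2" using \<epsilon> by (intro power_mono) auto
  moreover have "1 = (norm q)\<^sup>2 + \<epsilon>\<^sup>2"
    using norm_orth_proj_Pythagoras[OF X(1), of z] z(2) \<epsilon>(1) by (simp add: q_def)
  ultimately have "1 / 2 \<le> (norm q)\<^sup>2" by (simp add: power_divide)
  then have "1 \<le> (sqrt 2 * norm q)\<^sup>2" by (simp add: power_mult_distrib)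
  then have "1 \<le> sqrt 2 * norm q" using power2_le_imp_le[of 1 "sqrt 2 * norm q"] by simp
  then have q0: "q \<noteq> 0" and inv: "1 / norm q \<le> sqrt 2" by (auto simp: divide_simps)
  have pX: "p \<in> X" unfolding p_def by (rule normalized_proj_in[OF X(1)])
  have p0: "p \<noteq> 0" using norm_normalized_proj[of X z] q0 by (auto simp: p_def q_def)
  have qE: "q \<in> E" and pE: "p \<in> E" using orth_proj_in[OF X(1)] X(2) pX by (auto simp: q_def)
  have Np: "N p > 0" using E pE p0 unfolding banach_subspace_def by force
  have Nq: "0 \<le> N q" "N q \<le> r" using E qE proj by (auto simp: banach_subspace_def q_def)
  have p_eq: "p = (1 / norm q) *\<^sub>R q" by (simp add: p_def q_def normalized_proj_def divide_inverse)
  have "N p = (1 / norm q) * N q" using E qE by (simp add: p_eq banach_subspace_def)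
  also have "\<dots> \<le> sqrt 2 * r" using inv Nq by (intro mult_mono) auto
  finally have Np_le: "N p \<le> sqrt 2 * r" .
  have "\<bar>b p v - pairing T p v\<bar> \<le> d * N p * norm v"
    using d(1) Y operator_into_dual_scale[OF b pX] pX p0 Np v by (rule eps_op_bound)
  also have "\<dots> \<le> d * (sqrt 2 * r) * norm v"
    using Np_le d(2) by (intro mult_right_mono mult_left_mono) auto
  finally have 1: "\<bar>b p v - pairing T p v\<bar> \<le> (sqrt 2 * r * d) * norm v" by (simp add: mult_ac)
  \<comment> \<open>Since \<open>T z = 0\<close>, the vector \<open>z\<close> may be subtracted from
    \<open>q\<close>, which brings in the interpolation error. Below,
    \<open>1 / norm q \<le> sqrt 2\<close> is rounded up to \<open>2\<close>.\<close>
  have "pairing T p v = (1 / norm q) * pairing T (q - z) v"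
    by (simp add: p_eq pairing_def blinfun.scaleR_right blinfun.scaleR_left blinfun.diff_right z(1))
  then have "\<bar>pairing T p v\<bar> = (1 / norm q) * \<bar>pairing T (q - z) v\<bar>" by (simp add: abs_mult)
  also have "\<dots> \<le> 2 * (R * \<epsilon> * norm v)"
    using R(2)[of "q - z" v] inv sqrt2_less_2 R(1) \<epsilon> by (intro mult_mono) auto
  finally have 2: "\<bar>pairing T p v\<bar> \<le> 2 * R * \<epsilon> * norm v" by simp
  have "\<bar>b p v\<bar> \<le> \<bar>b p v - pairing T p v\<bar> + \<bar>pairing T p v\<bar>" by linarith
  also have "\<dots> \<le> (sqrt 2 * r * d + 2 * R * \<epsilon>) * norm v"
    using 1 2 by (simp add: distrib_right)
  finally show ?thesis by (simp add: p_def \<epsilon>_def)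
qed

section \<open>Error estimate and convergence\<close>

theorem theorem2:
  fixes E :: "'m::{real_inner, banach} set"
    and norm_E :: "'m \<Rightarrow> real"
    and Mh :: "real \<Rightarrow> 'm set"
    and Vh :: "real \<Rightarrow> 'v::{real_inner, banach} set"
    and T :: "'m \<Rightarrow>\<^sub>L ('v \<Rightarrow>\<^sub>L real)"
    and Th :: "real \<Rightarrow> 'm \<Rightarrow> 'v \<Rightarrow> real"
    and z :: 'm
    and r :: real
  assumes E_banach: "banach_subspace E norm_E"
    and E_dense: "closure E = UNIV"
    and Mh_fin: "\<And>h. h > 0 \<Longrightarrow> finite_dim_subspace (Mh h)"
    and Vh_fin: "\<And>h. h > 0 \<Longrightarrow> finite_dim_subspace (Vh h)"
    and Mh_approaches: "approaches_space Mh"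
    and Vh_approaches: "approaches_space Vh"
    and Mh_sub_E: "\<And>h. h > 0 \<Longrightarrow> Mh h \<subseteq> E"
    and proj_E: "\<And>h m. h > 0 \<Longrightarrow> m \<in> E \<Longrightarrow> norm_E (orth_proj (Mh h) m) \<le> norm_E m"
    and Th_op: "\<And>h. h > 0 \<Longrightarrow> operator_into_dual (Mh h) (Vh h) (Th h)"
    and z_E: "z \<in> E"
    and z_null: "blinfun_apply T z = 0"
    and z_norm: "norm z = 1"
    and z_r: "norm_E z \<le> r"
  shows "(\<forall>h>0. \<forall>zh\<in>Mh h.
            eps_int (Mh h) z \<le> 1 / 2 \<longrightarrow>
            dual_norm (Vh h) (Th h zh) = alpha (Mh h) (Vh h) (Th h) \<longrightarrow>
            norm zh = 1 \<longrightarrow>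
            inner zh z \<ge> 0 \<longrightarrow>
            beta (Mh h) (Vh h) (Th h) > 0 \<longrightarrow>
            ereal (norm (zh - normalized_proj (Mh h) z))
              \<le> 4 / beta (Mh h) (Vh h) (Th h) *
                 (ereal (sqrt 2) * ereal r * eps_op norm_E (Mh h) (Vh h) (Th h) T
                  + 2 * rho UNIV UNIV (pairing T) * ereal (eps_int (Mh h) z)))
       \<and>
         (((\<lambda>h. eps_op norm_E (Mh h) (Vh h) (Th h) T) \<longlongrightarrow> 0) (at_right 0) \<longrightarrow>
          (\<exists>\<beta>s::real. \<beta>s > 0 \<and> (\<forall>h>0. ereal \<beta>s \<le> beta (Mh h) (Vh h) (Th h))) \<longrightarrow>
          (\<forall>zh :: real \<Rightarrow> 'm.
             (\<forall>h>0. zh h \<in> Mh h \<and>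
                    dual_norm (Vh h) (Th h (zh h)) = alpha (Mh h) (Vh h) (Th h) \<and>
                    norm (zh h) = 1 \<and>
                    inner (zh h) z \<ge> 0) \<longrightarrow>
             ((\<lambda>h. norm (zh h - z)) \<longlongrightarrow> 0) (at_right 0)))"
proof -
  obtain R where R: "0 \<le> R" "rho UNIV UNIV (pairing T) = ereal R"
    "\<And>\<mu> v. \<bar>pairing T \<mu> v\<bar> \<le> R * norm \<mu> * norm v"
    using rho_UNIV_real[of T] by metis
  let ?op = "\<lambda>h. eps_op norm_E (Mh h) (Vh h) (Th h) T"
  let ?\<beta> = "\<lambda>h. beta (Mh h) (Vh h) (Th h)"
  let ?p = "\<lambda>h. normalized_proj (Mh h) z"
  let ?\<epsilon> = "\<lambda>h. eps_int (Mh h) z"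
  have "z \<noteq> 0" using z_norm by auto
  then have r: "0 < r"
    using E_banach z_E z_r unfolding banach_subspace_def by (metis order_le_less order_less_le_trans)
  note subM = Mh_fin[THEN finite_dim_subspace_imp_subspace]
  note subV = Vh_fin[THEN finite_dim_subspace_imp_subspace]
  have eps_nonneg: "0 \<le> ?\<epsilon> h" for h by (simp add: eps_int_def)
  \<comment> \<open>A vanishing projection would give an interpolation error of
    \<open>1\<close>.\<close>
  have proj_nz: "orth_proj (Mh h) z \<noteq> 0" if "?\<epsilon> h \<le> 1 / 2" for h
    using that z_norm by (auto simp: eps_int_def)
  have stab: "c * norm (zh - ?p h) \<le> 2 * D"
    if "h > 0" "zh \<in> Mh h" "?\<epsilon> h \<le> 1 / 2"
      "dual_norm (Vh h) (Th h zh) = alpha (Mh h) (Vh h) (Th h)" "norm zh = 1" "inner zh z \<ge> 0"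
      "ereal c < ?\<beta> h" "0 \<le> D" "\<And>v. v \<in> Vh h \<Longrightarrow> \<bar>Th h (?p h) v\<bar> \<le> D * norm v"
    for h zh c D
    using Th_op[OF that(1)] subM[OF that(1)] subV[OF that(1)] that(2,5,4)
      normalized_proj_in[OF Mh_fin[OF that(1)]] norm_normalized_proj[OF proj_nz[OF that(3)]]
      inner_normalized_proj_nonneg[OF Mh_fin[OF that(1)] that(2,6)] that(8,9,7)
    by (rule inf_sup_stability)
  \<comment> \<open>With \<open>c\<close> below \<open>beta\<close> and \<open>d\<close> above the
    consistency error, both real, the estimate stays free of extended-real arithmetic.\<close>
  have error: "c * norm (zh - ?p h) \<le> 2 * (sqrt 2 * r * d + 2 * R * ?\<epsilon> h)"
    if h: "h > 0" and zh: "zh \<in> Mh h" "?\<epsilon> h \<le> 1 / 2"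
      "dual_norm (Vh h) (Th h zh) = alpha (Mh h) (Vh h) (Th h)" "norm zh = 1" "inner zh z \<ge> 0"
      "ereal c < ?\<beta> h" and d: "?op h \<le> ereal d"
    for h zh c d
  proof (rule stab[OF h zh])
    have "0 \<le> ereal d" using eps_op_nonneg d by (rule order_trans)
    then have d0: "0 \<le> d" by simp
    show "0 \<le> sqrt 2 * r * d + 2 * R * ?\<epsilon> h" using r d0 R(1) eps_nonneg[of h] by simp
    have "norm_E (orth_proj (Mh h) z) \<le> r" using proj_E[OF h z_E] z_r by simp
    then show "\<bar>Th h (?p h) v\<bar> \<le> (sqrt 2 * r * d + 2 * R * ?\<epsilon> h) * norm v" if "v \<in> Vh h" for v
      using E_banach Mh_fin[OF h] Mh_sub_E[OF h] subV[OF h] Th_op[OF h] z_null z_norm zh(2) d d0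
        R(1,3) that
      by (intro residual_normalized_proj_le[where N = norm_E and E = E])
  qed
  show ?thesis
  proof (intro conjI allI ballI impI)
    fix h :: real and zh
    assume h: "h > 0" and zh: "zh \<in> Mh h" "?\<epsilon> h \<le> 1 / 2"
      "dual_norm (Vh h) (Th h zh) = alpha (Mh h) (Vh h) (Th h)" "norm zh = 1" "inner zh z \<ge> 0"
      and \<beta>: "?\<beta> h > 0"
    let ?x = "norm (zh - ?p h)"
    let ?rhs = "ereal (sqrt 2) * ereal r * ?op h + 2 * rho UNIV UNIV (pairing T) * ereal (?\<epsilon> h)"
    show "ereal ?x \<le> 4 / ?\<beta> h * ?rhs"
    proof (cases "?\<beta> h")
      \<comment> \<open>This occurs for one-dimensional \<open>Mh h\<close>, where nothing nonzero
        is orthogonal to a unit vector. The factor \<open>4 / ?\<beta> h\<close> is then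
        \<open>0\<close>, so \<open>zh\<close> must equal the normalized projection. Boundedness of
        \<open>Th h\<close> gives a finite residual bound, and \<open>c\<close> may be arbitrarily
        large.\<close>
      case PInf
      obtain K where K: "\<And>\<mu> v. \<mu> \<in> Mh h \<Longrightarrow> v \<in> Vh h \<Longrightarrow> \<bar>Th h \<mu> v\<bar> \<le> K * norm \<mu> * norm v"
        using Th_op[OF h] unfolding operator_into_dual_def by blast
      have bd: "\<bar>Th h (?p h) v\<bar> \<le> \<bar>K\<bar> * norm v" if "v \<in> Vh h" for v
      proof -
        have "\<bar>Th h (?p h) v\<bar> \<le> K * norm v"
          using K[OF normalized_proj_in[OF Mh_fin[OF h]] that, of z]
            norm_normalized_proj[OF proj_nz[OF zh(2)]] by simp
        also have "\<dots> \<le> \<bar>K\<bar> * norm v" by (intro mult_right_mono) auto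
        finally show ?thesis .
      qed
      have x: "c * ?x \<le> 2 * \<bar>K\<bar>" for c
        by (rule stab[OF h zh _ _ bd]) (simp_all add: PInf)
      have "?x = 0"
        \<comment> \<open>For nonzero \<open>?x\<close> this choice of \<open>c\<close> would give
          \<open>2 * \<bar>K\<bar> + 1 \<le> 2 * \<bar>K\<bar>\<close>.\<close>
        using x[of "(2 * \<bar>K\<bar> + 1) / ?x"] by (cases "?x = 0") auto
      then show ?thesis by (simp add: PInf)
    next
      case (real B)
      then have B: "B > 0" using \<beta> by simp
      show ?thesis
      proof (cases "?op h")
        case (real d)
        let ?D = "sqrt 2 * r * d + 2 * R * ?\<epsilon> h"
        \<comment> \<open>The estimate is available for \<open>c < B\<close> only; it extends to
          \<open>B\<close> by letting \<open>c\<close> tend to \<open>B\<close> from the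
          left.\<close>
        have "B * ?x \<le> 2 * ?D"
        proof (rule tendsto_upperbound)
          show "((\<lambda>c. c * ?x) \<longlongrightarrow> B * ?x) (at_left B)" by (intro tendsto_intros)
          show "\<forall>\<^sub>F c in at_left B. c * ?x \<le> 2 * ?D"
            unfolding eventually_at_filter
            by (intro always_eventually allI impI error[OF h zh])
              (use \<open>?\<beta> h = ereal B\<close> real in auto)
        qed simp
        moreover have "0 \<le> ?D"
          using eps_op_nonneg[of norm_E "Mh h" "Vh h" "Th h" T] real r R(1) eps_nonneg[of h] by simp
        \<comment> \<open>The argument gives the factor \<open>2 / B\<close>; nonnegativity of
          \<open>?D\<close> allows the stated \<open>4 / B\<close>.\<close>
        ultimately have "?x \<le> 4 / B * ?D"
          using B by (simp add: field_simps)
        moreover have "?rhs = ereal ?D" by (simp add: real R(2) numeral_eq_ereal)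
        moreover have "4 / ?\<beta> h = ereal (4 / B)"
          using B by (simp add: \<open>?\<beta> h = ereal B\<close> numeral_eq_ereal)
        ultimately show ?thesis by simp
      next
        case PInf
        \<comment> \<open>Positivity of \<open>r\<close> matters here, because zero times infinity
          is zero in \<open>ereal\<close>.\<close>
        have "?rhs = \<infinity>" using r by (simp add: PInf R(2) numeral_eq_ereal)
        moreover have "4 / ?\<beta> h = ereal (4 / B)"
          using B by (simp add: \<open>?\<beta> h = ereal B\<close> numeral_eq_ereal)
        ultimately have "4 / ?\<beta> h * ?rhs = \<infinity>"
          using B by (simp only: ereal_mult_infty times_ereal.simps) simp
        then show ?thesis by (simp only: ereal_less_eq)
      qed (use eps_op_nonneg[of norm_E "Mh h" "Vh h" "Th h" T] in auto)
    qed (use \<beta> in auto)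
  next
    fix zh :: "real \<Rightarrow> 'm"
    assume op: "(?op \<longlongrightarrow> 0) (at_right 0)"
      and "\<exists>\<beta>s::real. \<beta>s > 0 \<and> (\<forall>h>0. ereal \<beta>s \<le> ?\<beta> h)"
      and zh: "\<forall>h>0. zh h \<in> Mh h \<and>
                    dual_norm (Vh h) (Th h (zh h)) = alpha (Mh h) (Vh h) (Th h) \<and>
                    norm (zh h) = 1 \<and> inner (zh h) z \<ge> 0"
    then obtain \<beta>s :: real where \<beta>s: "\<beta>s > 0" "\<And>h. h > 0 \<Longrightarrow> ereal \<beta>s \<le> ?\<beta> h" by blast
    \<comment> \<open>Halving gives a constant strictly below every \<open>?\<beta> h\<close>,
      uniformly in \<open>h\<close>.\<close>
    define c where "c = \<beta>s / 2"
    have c: "c > 0" "ereal c < ?\<beta> h" if "h > 0" for h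
      using \<beta>s(1) less_le_trans[OF _ \<beta>s(2)[OF that], of "ereal c"] by (auto simp: c_def)
    have pos: "\<forall>\<^sub>F h::real in at_right 0. h > 0" by (simp add: eventually_at_right_less)
    obtain xh where xh: "\<And>h. h > 0 \<Longrightarrow> xh h \<in> Mh h" "((\<lambda>h. norm (xh h - z)) \<longlongrightarrow> 0) (at_right 0)"
      using Mh_approaches unfolding approaches_space_def by blast
    have eps0: "(?\<epsilon> \<longlongrightarrow> 0) (at_right 0)"
    proof (rule tendsto_sandwich[OF _ _ tendsto_const xh(2)])
      show "\<forall>\<^sub>F h in at_right 0. ?\<epsilon> h \<le> norm (xh h - z)"
        using pos
      proof eventually_elim
        case (elim h)
        show ?case using orth_proj_closest[OF Mh_fin[OF elim] xh(1)[OF elim], of z] z_norm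
          by (simp add: eps_int_def)
      qed
    qed (simp add: eps_nonneg)
    then have eps_small: "\<forall>\<^sub>F h in at_right 0. ?\<epsilon> h < 1 / 2"
      by (rule order_tendstoD) simp
    have op_small: "\<forall>\<^sub>F h in at_right 0. ?op h < 1" by (rule order_tendstoD[OF op]) simp
    have op_real: "((\<lambda>h. real_of_ereal (?op h)) \<longlongrightarrow> 0) (at_right 0)"
      using lim_real_of_ereal[of ?op 0] op by (simp add: zero_ereal_def)
    \<comment> \<open>The first term bounds the distance from \<open>zh h\<close> to the normalized
      projection, the second the distance from there to \<open>z\<close>.\<close>
    let ?bd = "\<lambda>h. 2 * (sqrt 2 * r * real_of_ereal (?op h) + 2 * R * ?\<epsilon> h) / c + 2 * ?\<epsilon> h"
    have "(?bd \<longlongrightarrow> 2 * (sqrt 2 * r * 0 + 2 * R * 0) / c + 2 * 0) (at_right 0)"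
      using c(1)[of 1] by (intro tendsto_intros op_real eps0) auto
    then have bd0: "(?bd \<longlongrightarrow> 0) (at_right 0)" by simp
    show "((\<lambda>h. norm (zh h - z)) \<longlongrightarrow> 0) (at_right 0)"
    proof (rule tendsto_sandwich[OF _ _ tendsto_const bd0])
      show "\<forall>\<^sub>F h in at_right 0. norm (zh h - z) \<le> ?bd h"
        using pos eps_small op_small
      proof eventually_elim
        case (elim h)
        \<comment> \<open>Finiteness has to be known first, since \<open>real_of_ereal\<close> sends
          infinity to \<open>0\<close>.\<close>
        have "\<bar>?op h\<bar> \<noteq> \<infinity>"
          using elim(3) eps_op_nonneg[of norm_E "Mh h" "Vh h" "Th h" T] by (cases "?op h") auto
        then have "?op h \<le> ereal (real_of_ereal (?op h))" by (simp add: ereal_real)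
        then have "c * norm (zh h - ?p h)
            \<le> 2 * (sqrt 2 * r * real_of_ereal (?op h) + 2 * R * ?\<epsilon> h)"
          using elim zh c(2)[OF elim(1)] by (intro error) auto
        then have "norm (zh h - ?p h)
            \<le> 2 * (sqrt 2 * r * real_of_ereal (?op h) + 2 * R * ?\<epsilon> h) / c"
          using c(1)[OF elim(1)] by (simp add: pos_le_divide_eq mult.commute)
        moreover have "norm (?p h - z) \<le> 2 * ?\<epsilon> h"
          using norm_normalized_proj_diff_le[OF z_norm proj_nz[of h]] elim(2) z_norm
          by (simp add: eps_int_def)
        ultimately show ?case
          using norm_triangle_ineq[of "zh h - ?p h" "?p h - z"] by simp
      qed
    qed simp
  qed
qed

end
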